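(* Let $A$ and $B$ be compact metric spaces, let $f\colon A\to\mathbb{R}^n$ and $g\colon B\to\mathbb{R}^n$ be continuous mappings, and let $a\in A$, $b\in B$ be points such that $f(a)=g(b)$. If the mappings $f$ and $g$ are $C^0$ transverse at the pair $(a,b)$, then for any open sets $U_A\subset A$ and $U_B\subset B$ such that $a\in U_A$ and $b\in U_B$, $$\dim(\mathrm{Cl}(U_A))+\dim(\mathrm{Cl}(U_B))\ge n.$$
   Context: $\mathrm{Cl}$ denotes closure, and $\dim$ denotes topological dimension: for a compact metric space $X$, $\dim X$ is the least integer $m\ge -1$ such that for any $\epsilon>0$ there is an open $\epsilon$-covering of $X$ (a covering by open sets of diameter less than $\epsilon$) whose multiplicity does not exceed $m+1$ (i.e. every point lies in at most $m+1$ elements of the covering); if no such integer exists, $\dim X=\infty$. $\mathbb{R}^n$ carries the metric $\mathrm{dist}$ given by a norm. For continuous mappings $f_1,f_2\colon X\to\mathbb{R}^n$ of a topological space $X$, put $|f_1,f_2|_{C^0}=\sup_{x\in X}\mathrm{dist}(f_1(x),f_2(x))$. For topological spaces $X,Y$, continuous mappings $h_1\colon X\to\mathbb{R}^n$, $h_2\colon Y\to\mathbb{R}^n$, arbitrary subsets $U_X\subset X$, $U_Y\subset Y$, and $\delta>0$, the intersection $h_1(U_X)\cap h_2(U_Y)$ is called $\delta$-essential if $\widetilde{h_1}(U_X)\cap\widetilde{h_2}(U_Y)\ne\varnothing$ for any continuous mappings $\widetilde{h_1}\colon X\to\mathbb{R}^n$ and $\widetilde{h_2}\colon Y\to\mathbb{R}^n$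 with $|h_1,\widetilde{h_1}|_{C^0}\le\delta$ and $|h_2,\widetilde{h_2}|_{C^0}\le\delta$. If $h_1(x)=h_2(y)$ for points $x\in X$, $y\in Y$, then $h_1$ and $h_2$ are called $C^0$ transverse at the pair $(x,y)$ if for any open sets $U(x)\subset X$ and $U(y)\subset Y$ with $x\in U(x)$ and $y\in U(y)$ there exists $\delta>0$ such that the intersection $h_1(U(x))\cap h_2(U(y))$ is $\delta$-essential. *)

theory Defs
  imports "HOL-Analysis.Analysis"
begin

text \<open>
  Spaces are subsets of a type, carrying the subspace topology (and the restricted metric);
  maps out of a space \<open>X\<close> matter only through their values on \<open>X\<close>.
  The target is \<open>real ^ 'n\<close> with the metric induced by an arbitrary norm \<open>N\<close>,
  not necessarily the Euclidean one.
\<close>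

definition is_norm :: "('v::real_vector \<Rightarrow> real) \<Rightarrow> bool" where
  "is_norm N \<longleftrightarrow>
     (\<forall>x. N x = 0 \<longleftrightarrow> x = 0) \<and>
     (\<forall>x y. N (x + y) \<le> N x + N y) \<and>
     (\<forall>c x. N (c *\<^sub>R x) = \<bar>c\<bar> * N x)"

text \<open>The supremum is taken in \<open>[0,\<infinity>]\<close>, since the maps may be unbounded.\<close>

definition C0_dist ::
  "('v::real_vector \<Rightarrow> real) \<Rightarrow> 'a set \<Rightarrow> ('a \<Rightarrow> 'v) \<Rightarrow> ('a \<Rightarrow> 'v) \<Rightarrow> ennreal" where
  "C0_dist N X f1 f2 = (SUP x\<in>X. ennreal (N (f1 x - f2 x)))"

definition essential_intersection ::
  "(real ^ 'n \<Rightarrow> real) \<Rightarrow> 'a::topological_space set \<Rightarrow> 'b::topological_space set \<Rightarrow>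
   ('a \<Rightarrow> real ^ 'n) \<Rightarrow> ('b \<Rightarrow> real ^ 'n) \<Rightarrow> 'a set \<Rightarrow> 'b set \<Rightarrow> real \<Rightarrow> bool" where
  "essential_intersection N X Y h1 h2 U V \<delta> \<longleftrightarrow>
     (\<forall>h1' h2'. continuous_on X h1' \<and> continuous_on Y h2' \<and>
        C0_dist N X h1 h1' \<le> ennreal \<delta> \<and> C0_dist N Y h2 h2' \<le> ennreal \<delta> \<longrightarrow>
        h1' ` U \<inter> h2' ` V \<noteq> {})"

definition C0_transverse_at ::
  "(real ^ 'n \<Rightarrow> real) \<Rightarrow> 'a::topological_space set \<Rightarrow> 'b::topological_space set \<Rightarrow>
   ('a \<Rightarrow> real ^ 'n) \<Rightarrow> ('b \<Rightarrow> real ^ 'n) \<Rightarrow> 'a \<Rightarrow> 'b \<Rightarrow> bool" where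
  "C0_transverse_at N X Y h1 h2 x y \<longleftrightarrow>
     h1 x = h2 y \<and>
     (\<forall>U V. openin (top_of_set X) U \<and> openin (top_of_set Y) V \<and> x \<in> U \<and> y \<in> V \<longrightarrow>
        (\<exists>\<delta>>0. essential_intersection N X Y h1 h2 U V \<delta>))"

definition open_eps_covering :: "'a::metric_space set \<Rightarrow> real \<Rightarrow> 'a set set \<Rightarrow> bool" where
  "open_eps_covering X \<epsilon> \<U> \<longleftrightarrow>
     (\<forall>U\<in>\<U>. openin (top_of_set X) U \<and> diameter U < \<epsilon>) \<and> \<Union>\<U> = X"

definition multiplicity_at_most :: "'a set \<Rightarrow> 'a set set \<Rightarrow> int \<Rightarrow> bool" where
  "multiplicity_at_most X \<U> k \<longleftrightarrow>
     (\<forall>x\<in>X. finite {U \<in> \<U>. x \<in> U} \<and> int (card {U \<in> \<U>. x \<in> U}) \<le> k)"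

text \<open>
  Intended for compact \<open>X\<close> only (\<open>diameter\<close> is meaningless on unbounded sets). The infimum of a
  nonempty set of integers bounded below is its least element, and the infimum of the
  empty set is \<open>\<infinity>\<close>.
\<close>

definition top_dim :: "'a::metric_space set \<Rightarrow> ereal" where
  "top_dim X = Inf {ereal (of_int m) | m :: int. m \<ge> -1 \<and>
     (\<forall>\<epsilon>>0. \<exists>\<U>. open_eps_covering X \<epsilon> \<U> \<and> multiplicity_at_most X \<U> (m + 1))}"

end

theory Submission
  imports Defs
begin

text \<open>
  If the dimensions \<open>p\<close> and \<open>q\<close> of the two closures satisfied \<open>p + q < n\<close>, the two images could be
  pulled apart by arbitrarily small perturbations, contradicting transversality.

  Cover the closure \<open>K\<close> of \<open>U\<^sub>A\<close> by finitely many small open sets, at most \<open>p + 1\<close> of them through any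
  point, attach to each covering set a point of \<open>\<real>\<^sup>n\<close> near the image of that set, and
  use a partition of unity to send \<open>x\<close> to a convex combination of the points attached to the sets
  that contain \<open>x\<close>. The result is uniformly close to \<open>f\<close> on \<open>K\<close> and takes its values in simplices
  with at most \<open>p + 1\<close> vertices. The same applies to \<open>g\<close> on the closure \<open>L\<close> of \<open>U\<^sub>B\<close>, with at most \<open>q + 1\<close>
  vertices (\<open>nerve_approximation\<close>). All the attached points, those for \<open>f\<close> and those for \<open>g\<close>
  together, can be moved slightly into general position (\<open>general_position_perturbation\<close>):
  any \<open>n + 1\<close> of them are affinely independent. A simplex used by \<open>f\<close> and one used by \<open>g\<close> have
  together at most \<open>p + q + 2 \<le> n + 1\<close> vertices, so they span disjoint faces of one simplex, and
  hence the two new images are disjoint (\<open>disjoint_perturbations\<close>).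

  Transversality quantifies over perturbations of the maps on all of \<open>A\<close> and \<open>B\<close>, whereas the
  construction lives on \<open>K\<close> and \<open>L\<close>. The difference between new and old map is therefore
  extended by Tietze's theorem and then projected to a small closed ball, which keeps the
  perturbation small (\<open>extend_perturbation\<close>). The whole construction is carried out in the
  Euclidean norm; a constant \<open>C\<close> with \<open>N x \<le> C * norm x\<close> transfers the estimates to \<open>N\<close>.
\<close>

section \<open>Points in general position\<close>

text \<open>
  At most \<open>n\<close> points span an affine subspace of dimension less than \<open>n\<close>, which has measure zero,
  and a finite union of such subspaces cannot fill a ball.
\<close>

lemma ball_not_covered_by_small_affine_hulls:
  fixes c :: "'v::euclidean_space"
  assumes "finite P" "r > 0"
  obtains z where "dist c z < r"
    and "\<And>T. T \<subseteq> P \<Longrightarrow> card T \<le> DIM('v) \<Longrightarrow> z \<notin> affine hull T"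
proof -
  let ?F = "{affine hull T |T. T \<subseteq> P \<and> card T \<le> DIM('v)}"
  have "finite ?F"
    using assms(1) by (auto intro: finite_subset[of _ "(\<lambda>T. affine hull T) ` Pow P"])
  moreover have "negligible H" if H: "H \<in> ?F" for H
  proof -
    obtain T where T: "H = affine hull T" "T \<subseteq> P" "card T \<le> DIM('v)"
      using H by blast
    then have "interior H = {}"
      using empty_interior_affine_hull assms(1) finite_subset by metis
    then show ?thesis
      using T(1) by (simp add: negligible_convex_interior affine_imp_convex)
  qed
  ultimately have "negligible (\<Union>?F)"
    by blast
  moreover have "\<not> negligible (ball c r)"
    using assms(2) by (simp add: open_not_negligible)
  ultimately obtain z where "z \<in> ball c r" "z \<notin> \<Union>?F"
    by (meson negligible_subset subsetI)
  then show thesis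
    by (intro that[of z]) auto
qed

text \<open>
  The points are moved one after the other, each new one avoiding the affine hulls of all sets of at
  most \<open>n\<close> points chosen before. Injectivity matters later: disjoint sets of indices must give
  disjoint sets of vertices.
\<close>

lemma general_position_perturbation:
  fixes c :: "'i \<Rightarrow> 'v::euclidean_space"
  assumes "finite I" "r > 0"
  obtains v where "inj_on v I" and "\<And>i. i \<in> I \<Longrightarrow> dist (c i) (v i) < r"
    and "\<And>S. S \<subseteq> v ` I \<Longrightarrow> card S \<le> DIM('v) + 1 \<Longrightarrow> \<not> affine_dependent S"
proof -
  have "\<exists>v. inj_on v I \<and> (\<forall>i\<in>I. dist (c i) (v i) < r) \<and>
          (\<forall>S. S \<subseteq> v ` I \<and> card S \<le> DIM('v) + 1 \<longrightarrow> \<not> affine_dependent S)"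
    using assms(1)
  proof (induction I)
    case empty
    show ?case by simp
  next
    case (insert j I)
    then obtain v where inj: "inj_on v I" and close: "\<And>i. i \<in> I \<Longrightarrow> dist (c i) (v i) < r"
      and indep: "\<And>S. S \<subseteq> v ` I \<Longrightarrow> card S \<le> DIM('v) + 1 \<Longrightarrow> \<not> affine_dependent S"
      by auto
    obtain z where z: "dist (c j) z < r"
      "\<And>T. T \<subseteq> v ` I \<Longrightarrow> card T \<le> DIM('v) \<Longrightarrow> z \<notin> affine hull T"
      using ball_not_covered_by_small_affine_hulls[of "v ` I" r "c j"] insert.hyps(1) assms(2)
      by blast
    \<comment> \<open>a single earlier point is its own affine hull, and \<open>1 \<le> DIM('v)\<close>\<close>
    have z_new: "z \<notin> v ` I"
    proof
      assume "z \<in> v ` I"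
      then have "z \<notin> affine hull {z}"
        using z(2)[of "{z}"] by (simp add: Suc_leI)
      then show False by simp
    qed
    define w where "w = v(j := z)"
    have w_I: "w ` I = v ` I" and w_j: "w j = z"
      using insert.hyps(2) by (auto simp: w_def)
    have "inj_on w (insert j I)"
      using inj z_new insert.hyps(2) by (auto simp: w_def inj_on_def)
    moreover have "\<forall>i\<in>insert j I. dist (c i) (w i) < r"
      using close z(1) by (auto simp: w_def)
    moreover have "\<not> affine_dependent S"
      if S: "S \<subseteq> w ` insert j I" "card S \<le> DIM('v) + 1" for S
    proof (cases "z \<in> S")
      case False
      then have "S \<subseteq> v ` I"
        using S(1) w_I w_j by auto
      then show ?thesis using S(2) indep by blast
    next
      case True
      have sub: "S - {z} \<subseteq> v ` I"
        using S(1) w_I w_j by auto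
      have fin: "finite S"
        using S(1) insert.hyps(1) finite_surj by blast
      have card: "card (S - {z}) \<le> DIM('v)"
        using S(2) True fin by simp
      have "\<not> affine_dependent (insert z (S - {z}))"
        using affine_independent_insert[OF indep[OF sub] z(2)[OF sub card]] card by simp
      then show ?thesis using True by (simp add: insert_absorb)
    qed
    ultimately show ?case by blast
  qed
  then show thesis using that by blast
qed

section \<open>Maps into the nerve of a covering\<close>

text \<open>
  The canonical map to the nerve of the covering, realised with vertices \<open>v U\<close>: its
  barycentric coordinates are the distances to the complements of the covering sets, divided by their
  sum.
\<close>

lemma convex_combination_over_open_cover:
  fixes K :: "'a::metric_space set" and v :: "'a set \<Rightarrow> 'v::real_normed_vector"
  assumes "finite \<U>" and "\<And>U. U \<in> \<U> \<Longrightarrow> openin (top_of_set K) U" and "\<Union>\<U> = K"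
  obtains F where "continuous_on K F"
    and "\<And>x. x \<in> K \<Longrightarrow> F x \<in> convex hull (v ` {U \<in> \<U>. x \<in> U})"
proof -
  \<comment> \<open>\<open>infdist\<close> to the empty set is \<open>0\<close>, so a covering set equal to \<open>K\<close> needs its own weight\<close>
  define w :: "'a set \<Rightarrow> 'a \<Rightarrow> real" where
    "w U x = (if K \<subseteq> U then 1 else infdist x (K - U))" for U x
  have w_cont: "continuous_on K (w U)" for U
    unfolding w_def by (cases "K \<subseteq> U") (auto intro!: continuous_intros)
  have w_nonneg: "0 \<le> w U x" for U x
    by (simp add: w_def infdist_nonneg)
  have w_pos: "0 < w U x \<longleftrightarrow> x \<in> U" if U: "U \<in> \<U>" and x: "x \<in> K" for U x
  proof (cases "K \<subseteq> U")
    case True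
    then show ?thesis using x by (auto simp: w_def)
  next
    case False
    obtain T where T: "open T" "U = K \<inter> T"
      using assms(2)[OF U] unfolding openin_open by blast
    have "w U x = 0 \<longleftrightarrow> x \<in> closure (K - U)"
      using False in_closure_iff_infdist_zero[of "K - U" x] by (auto simp: w_def)
    also have "\<dots> \<longleftrightarrow> x \<notin> U"
    proof
      have "closure (K - U) \<subseteq> - T"
        using T by (intro closure_minimal) auto
      then show "x \<in> closure (K - U) \<Longrightarrow> x \<notin> U" using T by blast
      show "x \<notin> U \<Longrightarrow> x \<in> closure (K - U)"
        using x closure_subset[of "K - U"] by blast
    qed
    finally show ?thesis using w_nonneg[of U x] by linarith
  qed
  define W where "W x = (\<Sum>U\<in>\<U>. w U x)" for x
  have W_pos: "0 < W x" if x: "x \<in> K" for x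
  proof -
    obtain U where "U \<in> \<U>" "x \<in> U" using x assms(3) by blast
    then show ?thesis
      unfolding W_def using x w_pos w_nonneg assms(1) by (intro sum_pos2[of _ U]) auto
  qed
  define F where "F x = (\<Sum>U\<in>\<U>. (w U x / W x) *\<^sub>R v U)" for x
  have "continuous_on K F"
    unfolding F_def W_def
    by (intro continuous_intros w_cont) (use W_pos in \<open>force simp: W_def\<close>)
  moreover have "F x \<in> convex hull (v ` {U \<in> \<U>. x \<in> U})" if x: "x \<in> K" for x
  proof -
    let ?S = "{U \<in> \<U>. x \<in> U}"
    have zero: "w U x = 0" if "U \<in> \<U> - ?S" for U
      using that w_pos[of U x] w_nonneg[of U x] x by force
    have F_eq: "F x = (\<Sum>U\<in>?S. (w U x / W x) *\<^sub>R v U)"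
      unfolding F_def by (rule sum.mono_neutral_right) (use assms(1) zero in auto)
    have "(\<Sum>U\<in>?S. w U x) = W x"
      unfolding W_def by (rule sum.mono_neutral_left) (use assms(1) zero in auto)
    then have "(\<Sum>U\<in>?S. w U x / W x) = 1"
      using W_pos[OF x] by (simp flip: sum_divide_distrib)
    then show ?thesis
      unfolding F_eq using assms(1) w_nonneg W_pos[OF x]
      by (intro convex_sum) (auto intro: hull_inc simp: less_imp_le)
  qed
  ultimately show thesis using that by blast
qed

section \<open>Extending a small perturbation\<close>

text \<open>
  Metrizability gives normality, and on a normal space the real-valued Tietze theorem applies to
  each coordinate.
\<close>

lemma Tietze_extension_euclidean_space:
  fixes h :: "'a::metric_space \<Rightarrow> 'v::euclidean_space"
  assumes "closedin (top_of_set A) K" "continuous_on K h"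
  obtains H where "continuous_on A H" "\<And>x. x \<in> K \<Longrightarrow> H x = h x"
proof -
  have normal: "normal_space (top_of_set A)"
    by (simp add: metrizable_imp_normal_space metrizable_space_subtopology metrizable_space_euclidean)
  have K: "K \<subseteq> A" using assms(1) closedin_imp_subset by blast
  have "\<exists>G. continuous_on A G \<and> (\<forall>x\<in>K. G x = h x \<bullet> b)" for b
  proof -
    have "continuous_map (subtopology (top_of_set A) K) euclideanreal (\<lambda>x. h x \<bullet> b)"
      using assms(2) K by (simp add: subtopology_subtopology inf.absorb2 continuous_intros)
    then obtain G where "continuous_map (top_of_set A) euclideanreal G" "\<And>x. x \<in> K \<Longrightarrow> G x = h x \<bullet> b"
      using Tietze_extension_realinterval[OF normal assms(1), of UNIV] by auto
    then show ?thesis by auto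
  qed
  then obtain G where G: "\<And>b. continuous_on A (G b)" "\<And>b x. x \<in> K \<Longrightarrow> G b x = h x \<bullet> b"
    by metis
  show thesis
  proof
    show "continuous_on A (\<lambda>x. \<Sum>b\<in>Basis. G b x *\<^sub>R b)"
      by (intro continuous_intros G(1))
    show "(\<Sum>b\<in>Basis. G b x *\<^sub>R b) = h x" if "x \<in> K" for x
      using G(2)[OF that] by (simp add: euclidean_representation)
  qed
qed

text \<open>
  A coordinatewise extension of \<open>F - f\<close> may leave the ball of radius \<open>r\<close>; composing it with the
  nearest-point retraction onto that ball restores the bound, and changes nothing on \<open>K\<close>,
  where the bound already holds.
\<close>

lemma extend_perturbation:
  fixes f :: "'a::metric_space \<Rightarrow> 'v::euclidean_space"
  assumes "closedin (top_of_set A) K" "continuous_on A f" "continuous_on K F"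
    and "r \<ge> 0" and "\<And>x. x \<in> K \<Longrightarrow> dist (f x) (F x) \<le> r"
  obtains f' where "continuous_on A f'" "\<And>x. x \<in> A \<Longrightarrow> dist (f x) (f' x) \<le> r"
    "\<And>x. x \<in> K \<Longrightarrow> f' x = F x"
proof -
  have K: "K \<subseteq> A" using assms(1) closedin_imp_subset by blast
  have diff: "continuous_on K (\<lambda>x. F x - f x)"
    using assms(3) continuous_on_subset[OF assms(2) K] by (rule continuous_on_diff)
  obtain H where H: "continuous_on A H" "\<And>x. x \<in> K \<Longrightarrow> H x = F x - f x"
    using Tietze_extension_euclidean_space[OF assms(1) diff] by blast
  let ?cp = "closest_point (cball (0::'v) r)"
  show thesis
  proof
    have "continuous_on A (\<lambda>x. ?cp (H x))"
      by (rule continuous_on_compose2[OF continuous_on_closest_point[of _ UNIV] H(1)])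
        (use assms(4) in auto)
    then show "continuous_on A (\<lambda>x. f x + ?cp (H x))"
      by (rule continuous_on_add[OF assms(2)])
    show "dist (f x) (f x + ?cp (H x)) \<le> r" for x
    proof -
      have "?cp (H x) \<in> cball 0 r"
        using assms(4) by (intro closest_point_in_set) auto
      then show ?thesis by (simp add: dist_norm)
    qed
    show "f x + ?cp (H x) = F x" if "x \<in> K" for x
    proof -
      have "H x \<in> cball 0 r"
        using assms(5)[OF that] H(2)[OF that] by (simp add: dist_norm norm_minus_commute)
      then have "?cp (H x) = H x" by (rule closest_point_self)
      then show ?thesis using H(2)[OF that] by simp
    qed
  qed
qed

section \<open>Coverings and dimension\<close>

definition coverings_of_order :: "'a::metric_space set \<Rightarrow> int \<Rightarrow> bool" where
  "coverings_of_order X m \<longleftrightarrow>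
     (\<forall>\<epsilon>>0. \<exists>\<U>. open_eps_covering X \<epsilon> \<U> \<and> multiplicity_at_most X \<U> (m + 1))"

text \<open>
  The admissible \<open>m\<close> are integers bounded below by \<open>-1\<close>, so their infimum is one of them as soon
  as there is any. Shifting by one turns it into a least natural number.
\<close>

lemma top_dim_attained:
  assumes "top_dim X \<noteq> \<infinity>"
  obtains m where "top_dim X = ereal (of_int m)" "coverings_of_order X m"
proof -
  let ?P = "\<lambda>m. m \<ge> -1 \<and> coverings_of_order X m"
  have dim_eq: "top_dim X = Inf {ereal (of_int m) | m :: int. ?P m}"
    unfolding top_dim_def coverings_of_order_def ..
  have "\<exists>m. ?P m"
  proof (rule ccontr)
    assume "\<nexists>m. ?P m"
    then have "top_dim X = Inf {}" unfolding dim_eq by (intro arg_cong[where f = Inf]) blast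
    then show False using assms by (simp add: top_ereal_def)
  qed
  then obtain m0 where "?P m0" by blast
  define k where "k = (LEAST k::nat. ?P (int k - 1))"
  have ex: "?P (int (nat (m0 + 1)) - 1)"
    using \<open>?P m0\<close> by simp
  have k: "?P (int k - 1)"
    unfolding k_def by (rule LeastI, rule ex)
  have least: "int k - 1 \<le> m" if "?P m" for m
  proof -
    have "?P (int (nat (m + 1)) - 1)" using that by simp
    then have "k \<le> nat (m + 1)" unfolding k_def by (rule Least_le)
    then show ?thesis using that by linarith
  qed
  have "top_dim X = ereal (of_int (int k - 1))"
    unfolding dim_eq
  proof (rule antisym)
    show "Inf {ereal (of_int m) | m :: int. ?P m} \<le> ereal (of_int (int k - 1))"
      by (rule Inf_lower) (use k in blast)
    show "ereal (of_int (int k - 1)) \<le> Inf {ereal (of_int m) | m :: int. ?P m}"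
      by (rule Inf_greatest) (use least in \<open>force simp del: of_int_diff\<close>)
  qed
  then show thesis using k that by blast
qed

lemma top_dim_not_minus_infinity: "top_dim X \<noteq> -\<infinity>"
proof -
  have "ereal (-1) \<le> top_dim X"
    unfolding top_dim_def by (rule Inf_greatest) auto
  then show ?thesis by auto
qed

text \<open>
  Uniform continuity converts small diameters in \<open>K\<close> into small diameters of images, and passing to a
  finite subcovering can only lower the multiplicity.
\<close>

lemma finite_covering_with_small_images:
  fixes f :: "'a::metric_space \<Rightarrow> 'v::metric_space"
  assumes "compact K" "continuous_on K f" "coverings_of_order K m" "r > 0"
  obtains \<U> where "finite \<U>" and "\<And>U. U \<in> \<U> \<Longrightarrow> openin (top_of_set K) U" and "\<Union>\<U> = K"
    and "\<And>U x y. U \<in> \<U> \<Longrightarrow> x \<in> U \<Longrightarrow> y \<in> U \<Longrightarrow> dist (f x) (f y) < r"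
    and "\<And>x. x \<in> K \<Longrightarrow> int (card {U \<in> \<U>. x \<in> U}) \<le> m + 1"
proof -
  have "uniformly_continuous_on K f"
    using assms(1,2) compact_uniformly_continuous by blast
  then obtain e where e: "e > 0"
    "\<And>x y. x \<in> K \<Longrightarrow> y \<in> K \<Longrightarrow> dist x y < e \<Longrightarrow> dist (f x) (f y) < r"
    unfolding uniformly_continuous_on_def using assms(4) by metis
  obtain \<V> where V: "open_eps_covering K e \<V>" "multiplicity_at_most K \<V> (m + 1)"
    using assms(3) e(1) unfolding coverings_of_order_def by blast
  have Vopen: "\<And>U. U \<in> \<V> \<Longrightarrow> openin (top_of_set K) U" and Vdiam: "\<And>U. U \<in> \<V> \<Longrightarrow> diameter U < e"
    and VK: "\<Union>\<V> = K"
    using V(1) unfolding open_eps_covering_def by auto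
  obtain \<U> where U: "\<U> \<subseteq> \<V>" "finite \<U>" "K \<subseteq> \<Union>\<U>"
    using assms(1) Vopen VK unfolding compact_eq_openin_cover by (metis order_refl)
  show thesis
  proof
    show "\<Union>\<U> = K" using U VK by blast
    show "dist (f x) (f y) < r" if "U \<in> \<U>" "x \<in> U" "y \<in> U" for U x y
    proof -
      have UK: "U \<subseteq> K" using that(1) U(1) VK by blast
      then have "bounded U" using assms(1) bounded_subset compact_imp_bounded by blast
      then have "dist x y < e"
        using diameter_bounded_bound[of U x y] Vdiam[of U] that U(1) by force
      then show ?thesis using e(2) UK that by blast
    qed
    show "int (card {U \<in> \<U>. x \<in> U}) \<le> m + 1" if "x \<in> K" for x
    proof -
      have "finite {U \<in> \<V>. x \<in> U}" "int (card {U \<in> \<V>. x \<in> U}) \<le> m + 1"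
        using V(2) that unfolding multiplicity_at_most_def by auto
      moreover have "{U \<in> \<U>. x \<in> U} \<subseteq> {U \<in> \<V>. x \<in> U}" using U(1) by blast
      ultimately show ?thesis using card_mono[of "{U \<in> \<V>. x \<in> U}" "{U \<in> \<U>. x \<in> U}"] by linarith
    qed
  qed (use U Vopen in auto)
qed

section \<open>Pushing two low-dimensional images apart\<close>

text \<open>
  The vertices belonging to a point \<open>x\<close> lie in the ball of radius \<open>r\<close> around \<open>f x\<close>. The ball is convex,
  so it contains every convex combination of them as well.
\<close>

lemma nerve_approximation:
  fixes f :: "'a::metric_space \<Rightarrow> 'v::euclidean_space"
  assumes "closedin (top_of_set A) K" "continuous_on A f"
    and "finite \<U>" "\<And>U. U \<in> \<U> \<Longrightarrow> openin (top_of_set K) U" "\<Union>\<U> = K"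
    and "r > 0" and near: "\<And>U x. U \<in> \<U> \<Longrightarrow> x \<in> U \<Longrightarrow> dist (f x) (v U) \<le> r"
  obtains f' where "continuous_on A f'" "\<And>x. x \<in> A \<Longrightarrow> dist (f x) (f' x) \<le> r"
    "\<And>x. x \<in> K \<Longrightarrow> f' x \<in> convex hull (v ` {U \<in> \<U>. x \<in> U})"
proof -
  obtain F where F: "continuous_on K F"
    "\<And>x. x \<in> K \<Longrightarrow> F x \<in> convex hull (v ` {U \<in> \<U>. x \<in> U})"
    using convex_combination_over_open_cover[OF assms(3-5)] by blast
  have close: "dist (f x) (F x) \<le> r" if "x \<in> K" for x
  proof -
    have "convex hull (v ` {U \<in> \<U>. x \<in> U}) \<subseteq> cball (f x) r"
      by (rule hull_minimal) (use near in auto)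
    then show ?thesis using F(2)[OF that] by auto
  qed
  obtain f' where f': "continuous_on A f'" "\<And>x. x \<in> A \<Longrightarrow> dist (f x) (f' x) \<le> r"
    "\<And>x. x \<in> K \<Longrightarrow> f' x = F x"
    using extend_perturbation[OF assms(1,2) F(1) less_imp_le[OF assms(6)] close] by blast
  show thesis
    by (rule that[OF f'(1,2)]) (use f'(3) F(2) in auto)
qed

text \<open>
  This is the general position argument. The dimension bound enters only through the vertex count
  \<open>(p + 1) + (q + 1) \<le> n + 1\<close>.
\<close>

lemma disjoint_perturbations:
  fixes f :: "'a::metric_space \<Rightarrow> 'v::euclidean_space" and g :: "'b::metric_space \<Rightarrow> 'v"
  assumes "compact K" "closedin (top_of_set A) K" "continuous_on A f" "coverings_of_order K p"
    and "compact L" "closedin (top_of_set B) L" "continuous_on B g" "coverings_of_order L q"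
    and dims: "p + q < int DIM('v)" and "r > 0"
  obtains f' g' where "continuous_on A f'" "\<And>x. x \<in> A \<Longrightarrow> dist (f x) (f' x) \<le> r"
    and "continuous_on B g'" "\<And>y. y \<in> B \<Longrightarrow> dist (g y) (g' y) \<le> r"
    and "f' ` K \<inter> g' ` L = {}"
proof -
  have r2: "r / 2 > 0" using assms(10) by simp
  have fK: "continuous_on K f" and gL: "continuous_on L g"
    using continuous_on_subset[OF assms(3) closedin_imp_subset[OF assms(2)]]
      continuous_on_subset[OF assms(7) closedin_imp_subset[OF assms(6)]] by simp_all
  obtain \<U> where U: "finite \<U>" "\<And>U. U \<in> \<U> \<Longrightarrow> openin (top_of_set K) U" "\<Union>\<U> = K"
    "\<And>U x y. U \<in> \<U> \<Longrightarrow> x \<in> U \<Longrightarrow> y \<in> U \<Longrightarrow> dist (f x) (f y) < r / 2"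
    "\<And>x. x \<in> K \<Longrightarrow> int (card {U \<in> \<U>. x \<in> U}) \<le> p + 1"
    using finite_covering_with_small_images[OF assms(1) fK assms(4) r2] by blast
  obtain \<W> where W: "finite \<W>" "\<And>U. U \<in> \<W> \<Longrightarrow> openin (top_of_set L) U" "\<Union>\<W> = L"
    "\<And>U x y. U \<in> \<W> \<Longrightarrow> x \<in> U \<Longrightarrow> y \<in> U \<Longrightarrow> dist (g x) (g y) < r / 2"
    "\<And>x. x \<in> L \<Longrightarrow> int (card {U \<in> \<W>. x \<in> U}) \<le> q + 1"
    using finite_covering_with_small_images[OF assms(5) gL assms(8) r2] by blast
  \<comment> \<open>The two coverings are indexed by one disjoint sum, so that all vertices can be put in general
    position simultaneously. An empty covering set gets a meaningless centre, but it contains no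
    point and so never contributes a vertex.\<close>
  define c where "c = case_sum (\<lambda>U. f (SOME x. x \<in> U)) (\<lambda>U. g (SOME x. x \<in> U))"
  have fin: "finite (\<U> <+> \<W>)" using U(1) W(1) by simp
  obtain v where inj: "inj_on v (\<U> <+> \<W>)"
    and vc: "\<And>i. i \<in> \<U> <+> \<W> \<Longrightarrow> dist (c i) (v i) < r / 2"
    and indep: "\<And>S. S \<subseteq> v ` (\<U> <+> \<W>) \<Longrightarrow> card S \<le> DIM('v) + 1 \<Longrightarrow> \<not> affine_dependent S"
    using general_position_perturbation[OF fin r2, of c] by blast
  have near_f: "dist (f x) ((v \<circ> Inl) U) \<le> r" if "U \<in> \<U>" "x \<in> U" for U x
  proof -
    have "dist (f x) (c (Inl U)) < r / 2"
      using U(4)[OF that someI[of "\<lambda>x. x \<in> U", OF that(2)]] by (simp add: c_def)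
    moreover have "dist (c (Inl U)) (v (Inl U)) < r / 2"
      using vc that by blast
    ultimately show ?thesis
      using dist_triangle[of "f x" "v (Inl U)" "c (Inl U)"] by simp
  qed
  have near_g: "dist (g x) ((v \<circ> Inr) U) \<le> r" if "U \<in> \<W>" "x \<in> U" for U x
  proof -
    have "dist (g x) (c (Inr U)) < r / 2"
      using W(4)[OF that someI[of "\<lambda>x. x \<in> U", OF that(2)]] by (simp add: c_def)
    moreover have "dist (c (Inr U)) (v (Inr U)) < r / 2"
      using vc that by blast
    ultimately show ?thesis
      using dist_triangle[of "g x" "v (Inr U)" "c (Inr U)"] by simp
  qed
  obtain f' where f': "continuous_on A f'" "\<And>x. x \<in> A \<Longrightarrow> dist (f x) (f' x) \<le> r"
    "\<And>x. x \<in> K \<Longrightarrow> f' x \<in> convex hull ((v \<circ> Inl) ` {U \<in> \<U>. x \<in> U})"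
    using nerve_approximation[where v = "v \<circ> Inl", OF assms(2,3) U(1-3) assms(10) near_f] by blast
  obtain g' where g': "continuous_on B g'" "\<And>x. x \<in> B \<Longrightarrow> dist (g x) (g' x) \<le> r"
    "\<And>x. x \<in> L \<Longrightarrow> g' x \<in> convex hull ((v \<circ> Inr) ` {U \<in> \<W>. x \<in> U})"
    using nerve_approximation[where v = "v \<circ> Inr", OF assms(6,7) W(1-3) assms(10) near_g] by blast
  have "f' x \<noteq> g' y" if x: "x \<in> K" and y: "y \<in> L" for x y
  proof -
    let ?S = "(v \<circ> Inl) ` {U \<in> \<U>. x \<in> U}" and ?T = "(v \<circ> Inr) ` {U \<in> \<W>. y \<in> U}"
    have "card ?S \<le> card {U \<in> \<U>. x \<in> U}" "card ?T \<le> card {U \<in> \<W>. y \<in> U}"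
      using U(1) W(1) by (auto intro: card_image_le)
    then have "card (?S \<union> ?T) \<le> DIM('v) + 1"
      using U(5)[OF x] W(5)[OF y] dims card_Un_le[of ?S ?T] by linarith
    then have "\<not> affine_dependent (?S \<union> ?T)"
      by (intro indep) auto
    moreover have "?S \<inter> ?T = {}"
      using inj by (fastforce dest: inj_onD)
    ultimately have "affine hull ?S \<inter> affine hull ?T = {}"
      using disjoint_affine_hull[of "?S \<union> ?T" ?S ?T] by blast
    moreover have "f' x \<in> affine hull ?S" "g' y \<in> affine hull ?T"
      by (rule subsetD[OF convex_hull_subset_affine_hull f'(3)[OF x]],
          rule subsetD[OF convex_hull_subset_affine_hull g'(3)[OF y]])
    ultimately show ?thesis by (auto simp only: disjoint_iff)
  qed
  then have disj: "f' ` K \<inter> g' ` L = {}" by blast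
  show thesis by (rule that[OF f'(1,2) g'(1,2) disj])
qed

section \<open>Transversality forces dimension\<close>

text \<open>
  Expanding \<open>x\<close> in the standard basis, \<open>N x\<close> is at most the sum of \<open>\<bar>x \<bullet> b\<bar> * N b\<close>. This makes a
  perturbation that is small in the Euclidean norm small for \<open>N\<close>.
\<close>

lemma is_norm_bounded_by_norm:
  fixes N :: "real ^ 'n \<Rightarrow> real"
  assumes "is_norm N"
  obtains C where "C > 0" "\<And>x. N x \<le> C * norm x"
proof -
  have zero: "N 0 = 0" and tri: "N (x + y) \<le> N x + N y" and scale: "N (s *\<^sub>R x) = \<bar>s\<bar> * N x"
    for x y s
    using assms unfolding is_norm_def by auto
  have nonneg: "0 \<le> N x" for x
    using tri[of x "-x"] scale[of "-1" x] zero by simp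
  have N_sum: "N (\<Sum>b\<in>S. h b) \<le> (\<Sum>b\<in>S. N (h b))" if "finite S" for S and h :: "real ^ 'n \<Rightarrow> real ^ 'n"
    using that by induction (auto simp: zero intro: order_trans[OF tri])
  let ?C = "\<Sum>b\<in>Basis. N (b :: real ^ 'n)"
  have bound: "N x \<le> ?C * norm x" for x
  proof -
    have "N x = N (\<Sum>b\<in>Basis. (x \<bullet> b) *\<^sub>R b)"
      by (simp add: euclidean_representation)
    also have "\<dots> \<le> (\<Sum>b\<in>Basis. N ((x \<bullet> b) *\<^sub>R b))"
      by (rule N_sum) simp
    also have "\<dots> \<le> (\<Sum>b\<in>Basis. norm x * N b)"
      by (rule sum_mono) (simp add: scale nonneg mult_right_mono Basis_le_norm)
    also have "\<dots> = ?C * norm x"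
      by (simp add: sum_distrib_left mult.commute)
    finally show ?thesis .
  qed
  show thesis
  proof
    show "?C + 1 > 0" using nonneg by (simp add: add_nonneg_pos sum_nonneg)
    show "N x \<le> (?C + 1) * norm x" for x
      using bound[of x] by (simp add: distrib_right add_increasing2)
  qed
qed

lemma C0_dist_le:
  assumes "\<And>x. N x \<le> C * norm x" "C > 0"
    and "\<And>x. x \<in> X \<Longrightarrow> dist (h x) (h' x) \<le> d / C"
  shows "C0_dist N X h h' \<le> ennreal d"
  unfolding C0_dist_def
proof (intro SUP_least ennreal_leI)
  fix x assume "x \<in> X"
  then have "norm (h x - h' x) * C \<le> d"
    using assms(2,3) by (simp add: dist_norm pos_le_divide_eq)
  then show "N (h x - h' x) \<le> d"
    using assms(1)[of "h x - h' x"] by (simp add: mult.commute)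
qed

theorem proposition4:
  fixes A :: "'a::metric_space set" and B :: "'b::metric_space set"
    and f :: "'a \<Rightarrow> real ^ 'n" and g :: "'b \<Rightarrow> real ^ 'n"
    and N :: "real ^ 'n \<Rightarrow> real"
    and a :: 'a and b :: 'b
  assumes "is_norm N"
    and "compact A" and "compact B"
    and "continuous_on A f" and "continuous_on B g"
    and "a \<in> A" and "b \<in> B" and "f a = g b"
    and "C0_transverse_at N A B f g a b"
  shows "\<forall>U\<^sub>A U\<^sub>B. openin (top_of_set A) U\<^sub>A \<and> openin (top_of_set B) U\<^sub>B \<and> a \<in> U\<^sub>A \<and> b \<in> U\<^sub>B \<longrightarrow>
           top_dim (top_of_set A closure_of U\<^sub>A) + top_dim (top_of_set B closure_of U\<^sub>B)
             \<ge> ereal (real CARD('n))"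
proof (intro allI impI, elim conjE)
  fix U\<^sub>A U\<^sub>B
  assume U: "openin (top_of_set A) U\<^sub>A" "openin (top_of_set B) U\<^sub>B" "a \<in> U\<^sub>A" "b \<in> U\<^sub>B"
  define K where "K = top_of_set A closure_of U\<^sub>A"
  define L where "L = top_of_set B closure_of U\<^sub>B"
  have K: "closedin (top_of_set A) K" "U\<^sub>A \<subseteq> K" and L: "closedin (top_of_set B) L" "U\<^sub>B \<subseteq> L"
    unfolding K_def L_def using U(1,2)
    by (simp_all add: openin_imp_subset closure_of_subset)
  have cpt: "compact K" "compact L"
    using K(1) L(1) assms(2,3) closedin_compact by blast+
  show "ereal (real CARD('n)) \<le> top_dim K + top_dim L"
  proof (rule ccontr)
    assume small: "\<not> ?thesis"
    then have "top_dim K \<noteq> \<infinity>" "top_dim L \<noteq> \<infinity>"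
      using top_dim_not_minus_infinity by auto
    then obtain p q where p: "top_dim K = ereal (of_int p)" "coverings_of_order K p"
      and q: "top_dim L = ereal (of_int q)" "coverings_of_order L q"
      by (elim top_dim_attained) blast
    have pq: "p + q < int DIM(real ^ 'n)"
      using small p(1) q(1) by simp
    obtain d where d: "d > 0" "essential_intersection N A B f g U\<^sub>A U\<^sub>B d"
      using assms(9) U unfolding C0_transverse_at_def by blast
    obtain C where C: "C > 0" "\<And>x. N x \<le> C * norm x"
      using is_norm_bounded_by_norm[OF assms(1)] by blast
    have "d / C > 0" using d C by simp
    obtain f' g' where f': "continuous_on A f'" "\<And>x. x \<in> A \<Longrightarrow> dist (f x) (f' x) \<le> d / C"
      and g': "continuous_on B g'" "\<And>y. y \<in> B \<Longrightarrow> dist (g y) (g' y) \<le> d / C"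
      and disj: "f' ` K \<inter> g' ` L = {}"
      by (rule disjoint_perturbations[OF cpt(1) K(1) assms(4) p(2) cpt(2) L(1) assms(5) q(2) pq
            \<open>d / C > 0\<close>]) blast
    have "C0_dist N A f f' \<le> ennreal d" "C0_dist N B g g' \<le> ennreal d"
      by (rule C0_dist_le[OF C(2,1) f'(2)], assumption, rule C0_dist_le[OF C(2,1) g'(2)])
    then have "f' ` U\<^sub>A \<inter> g' ` U\<^sub>B \<noteq> {}"
      using d(2)[unfolded essential_intersection_def, rule_format, of f' g'] f'(1) g'(1) by simp
    then show False using disj K(2) L(2) by blast
  qed
qed

end
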